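(* Let $f:A\to B$ be a homomorphism of commutative rings, let $J$ be an ideal of $B$, let $I$ be a proper ideal of $A$, let $\delta$ be an expansion function of $Id(A)$, and let $m,n$ be integers with $1\le n<m$. Let $\delta_{\bowtie^f}$ be the associated expansion function of $Id(A\bowtie^f J)$. Then the following statements are equivalent. (1) $I\bowtie^f J$ is a weakly $(m,n)$-closed $\delta_{\bowtie^f}$-primary ideal of $A\bowtie^f J$ that is not $(m,n)$-closed $\delta_{\bowtie^f}$-primary. (2) $I$ is a weakly $(m,n)$-closed $\delta$-primary ideal of $A$ that is not $(m,n)$-closed $\delta$-primary, and for every $\delta$-$(m,n)$-unbreakable-zero element $a$ of $I$ we have $(f(a)+j)^m=0$ for every $j\in J$.
   Context: All rings are commutative with $1\neq 0$ and ring homomorphisms preserve the identity. $Id(R)$ is the set of all ideals of a ring $R$. An expansion function of $Id(R)$ is a map $\delta:Id(R)\to Id(R)$ with $I\subseteq\delta(I)$ for all ideals $I$, and $\delta(I)\subseteq\delta(I')$ whenever $I\subseteq I'$. For positive integers $m,n$, a proper ideal $I$ of $R$ is $(m,n)$-closed $\delta$-primary if for all $a\in R$, $a^m\in I$ implies $a^n\in\delta(I)$; it is weakly $(m,n)$-closed $\delta$-primary if for all $a\in R$, $0\neq a^m\in I$ implies $a^n\in\delta(I)$. If $1\le n<m$ and $I$ is a weakly $(m,n)$-closed $\delta$-primary ideal of $R$, an element $a\in R$ is a $\delta$-$(m,n)$-unbreakable-zero element of $I$ if $a^m=0$ and $a^n\notin\delta(I)$. For a ring homomorphism $f:A\to B$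 and an ideal $J$ of $B$, the amalgamation is the subring $A\bowtie^f J=\{(a,f(a)+j)\mid a\in A,\ j\in J\}$ of $A\times B$. For an ideal $I$ of $A$, $I\bowtie^f J=\{(i,f(i)+j)\mid i\in I,\ j\in J\}$, an ideal of $A\bowtie^f J$. Given an expansion function $\delta$ of $Id(A)$, $\delta_{\bowtie^f}$ denotes an expansion function of $Id(A\bowtie^f J)$ with $\delta_{\bowtie^f}(I\bowtie^f J)=\delta(I)\bowtie^f J$ for every ideal $I$ of $A$. *)

theory Defs
  imports "HOL-Algebra.Chinese_Remainder"
begin

text \<open>Rings are commutative throughout; nontriviality (\<open>1 \<noteq> 0\<close>) is not part of \<^locale>\<open>cring\<close>
  and has to be assumed separately where it is wanted.\<close>

text \<open>Ideals are plain sets, so an expansion function is a function on all sets that is only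
  constrained on ideals.\<close>

definition expansion_function :: "('a, 'm) ring_scheme \<Rightarrow> ('a set \<Rightarrow> 'a set) \<Rightarrow> bool" where
  "expansion_function R \<delta> \<longleftrightarrow>
     (\<forall>I. ideal I R \<longrightarrow> ideal (\<delta> I) R \<and> I \<subseteq> \<delta> I) \<and>
     (\<forall>I I'. ideal I R \<longrightarrow> ideal I' R \<longrightarrow> I \<subseteq> I' \<longrightarrow> \<delta> I \<subseteq> \<delta> I')"

definition closed_primary ::
    "('a, 'm) ring_scheme \<Rightarrow> ('a set \<Rightarrow> 'a set) \<Rightarrow> nat \<Rightarrow> nat \<Rightarrow> 'a set \<Rightarrow> bool" where
  "closed_primary R \<delta> m n I \<longleftrightarrow>
     ideal I R \<and> I \<noteq> carrier R \<and>
     (\<forall>a \<in> carrier R. a [^]\<^bsub>R\<^esub> m \<in> I \<longrightarrow> a [^]\<^bsub>R\<^esub> n \<in> \<delta> I)"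

definition weakly_closed_primary ::
    "('a, 'm) ring_scheme \<Rightarrow> ('a set \<Rightarrow> 'a set) \<Rightarrow> nat \<Rightarrow> nat \<Rightarrow> 'a set \<Rightarrow> bool" where
  "weakly_closed_primary R \<delta> m n I \<longleftrightarrow>
     ideal I R \<and> I \<noteq> carrier R \<and>
     (\<forall>a \<in> carrier R. a [^]\<^bsub>R\<^esub> m \<noteq> \<zero>\<^bsub>R\<^esub> \<and> a [^]\<^bsub>R\<^esub> m \<in> I \<longrightarrow> a [^]\<^bsub>R\<^esub> n \<in> \<delta> I)"

definition unbreakable_zero ::
    "('a, 'm) ring_scheme \<Rightarrow> ('a set \<Rightarrow> 'a set) \<Rightarrow> nat \<Rightarrow> nat \<Rightarrow> 'a set \<Rightarrow> 'a \<Rightarrow> bool" where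
  "unbreakable_zero R \<delta> m n I a \<longleftrightarrow>
     1 \<le> n \<and> n < m \<and> weakly_closed_primary R \<delta> m n I \<and>
     a \<in> carrier R \<and> a [^]\<^bsub>R\<^esub> m = \<zero>\<^bsub>R\<^esub> \<and> a [^]\<^bsub>R\<^esub> n \<notin> \<delta> I"

text \<open>\<open>amalg_set B f J I\<close> is \<open>I \<bowtie>\<^sup>f J\<close>; the carrier of the amalgamation is the case
  where \<open>I\<close> is the whole ring.\<close>

definition amalg_set ::
    "('b, 'k) ring_scheme \<Rightarrow> ('a \<Rightarrow> 'b) \<Rightarrow> 'b set \<Rightarrow> 'a set \<Rightarrow> ('a \<times> 'b) set" where
  "amalg_set B f J I = {(i, f i \<oplus>\<^bsub>B\<^esub> j) | i j. i \<in> I \<and> j \<in> J}"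

definition amalgamation ::
    "('a, 'm) ring_scheme \<Rightarrow> ('b, 'k) ring_scheme \<Rightarrow> ('a \<Rightarrow> 'b) \<Rightarrow> 'b set \<Rightarrow> ('a \<times> 'b) ring" where
  "amalgamation A B f J = (RDirProd A B) \<lparr>carrier := amalg_set B f J (carrier A)\<rparr>"

end

theory Submission
  imports Defs "HOL-Algebra.Subrings"
begin

text \<open>An element \<open>(a, b)\<close> of the amalgamation lies in the extension of \<open>K\<close> iff \<open>a \<in> K\<close>, and
  powers are computed componentwise. Hence closedness of the extension of \<open>I\<close> is closedness of
  \<open>I\<close>, and for the weak variant the only difference is that \<open>(a, f a + j)\<^sup>m\<close> may be nonzero
  although \<open>a\<^sup>m = 0\<close>; this must not happen for an unbreakable zero \<open>a\<close>.\<close>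

lemma RDirProd_simps [simp]:
  "carrier (RDirProd R S) = carrier R \<times> carrier S"
  "(a, b) \<otimes>\<^bsub>RDirProd R S\<^esub> (c, d) = (a \<otimes>\<^bsub>R\<^esub> c, b \<otimes>\<^bsub>S\<^esub> d)"
  "(a, b) \<oplus>\<^bsub>RDirProd R S\<^esub> (c, d) = (a \<oplus>\<^bsub>R\<^esub> c, b \<oplus>\<^bsub>S\<^esub> d)"
  "\<zero>\<^bsub>RDirProd R S\<^esub> = (\<zero>\<^bsub>R\<^esub>, \<zero>\<^bsub>S\<^esub>)"
  "\<one>\<^bsub>RDirProd R S\<^esub> = (\<one>\<^bsub>R\<^esub>, \<one>\<^bsub>S\<^esub>)"
  by (auto simp: RDirProd_def DirProd_def monoid.defs)

lemma RDirProd_a_inv: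
  assumes "ring R" "ring S" "a \<in> carrier R" "b \<in> carrier S"
  shows "\<ominus>\<^bsub>RDirProd R S\<^esub> (a, b) = (\<ominus>\<^bsub>R\<^esub> a, \<ominus>\<^bsub>S\<^esub> b)"
proof -
  interpret R: ring R by fact
  interpret S: ring S by fact
  interpret RDirProd: ring "RDirProd R S" using assms by (intro RDirProd_ring)
  show ?thesis
    using assms by (intro RDirProd.minus_equality) (auto simp: R.l_neg S.l_neg)
qed

locale amalgamated_ring = ring_hom_ring A B f + J: ideal J B
  for A :: "('a, 'm) ring_scheme" and B :: "('b, 'k) ring_scheme"
    and f :: "'a \<Rightarrow> 'b" and J :: "'b set"
begin

text \<open>The \<open>j\<close> in a pair \<open>(i, f i + j)\<close> is determined as the
  difference of the second component and \<open>f i\<close>, so the existential over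
  \<open>j\<close> can be traded for a congruence modulo \<open>J\<close>. Closure properties then
  become identities for such differences.\<close>

lemma amalg_set_iff:
  assumes "K \<subseteq> carrier A"
  shows "(a, b) \<in> amalg_set B f J K \<longleftrightarrow> a \<in> K \<and> b \<in> carrier B \<and> b \<ominus>\<^bsub>B\<^esub> f a \<in> J"
proof (intro iffI)
  assume "(a, b) \<in> amalg_set B f J K"
  then obtain j where *: "a \<in> K" "j \<in> J" "b = f a \<oplus>\<^bsub>B\<^esub> j"
    by (auto simp: amalg_set_def)
  then have "b \<ominus>\<^bsub>B\<^esub> f a = j"
    using assms J.a_Hcarr by (auto simp: subset_eq S.minus_eq S.a_ac S.r_neg)
  then show "a \<in> K \<and> b \<in> carrier B \<and> b \<ominus>\<^bsub>B\<^esub> f a \<in> J"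
    using * assms J.a_Hcarr by auto
next
  assume *: "a \<in> K \<and> b \<in> carrier B \<and> b \<ominus>\<^bsub>B\<^esub> f a \<in> J"
  then have "f a \<oplus>\<^bsub>B\<^esub> (b \<ominus>\<^bsub>B\<^esub> f a) = b"
    using assms by (auto simp: subset_eq S.minus_eq S.a_lcomm S.r_neg)
  with * show "(a, b) \<in> amalg_set B f J K"
    unfolding amalg_set_def by force
qed

text \<open>The congruence of \<open>b\<close> and \<open>f a\<close> modulo the ideal
  \<open>J\<close> is compatible with the ring operations, because \<open>f\<close> is a
  homomorphism.\<close>

lemma amalg_set_subring: "subring (amalg_set B f J (carrier A)) (RDirProd A B)"
proof -
  interpret RDirProd: ring "RDirProd A B"
    using R.ring_axioms S.ring_axioms by (rule RDirProd_ring)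
  show ?thesis
  proof (intro RDirProd.subringI; clarify?)
    show "\<one>\<^bsub>RDirProd A B\<^esub> \<in> amalg_set B f J (carrier A)"
      by (simp add: amalg_set_iff S.minus_eq S.r_neg)
  next
    fix a b assume "(a, b) \<in> amalg_set B f J (carrier A)"
    then show "(a, b) \<in> carrier (RDirProd A B)" by (simp add: amalg_set_iff)
  next
    fix a b assume "(a, b) \<in> amalg_set B f J (carrier A)"
    then have *: "a \<in> carrier A" "b \<in> carrier B" "b \<ominus>\<^bsub>B\<^esub> f a \<in> J"
      by (simp_all add: amalg_set_iff)
    then have "\<ominus>\<^bsub>B\<^esub> b \<ominus>\<^bsub>B\<^esub> f (\<ominus>\<^bsub>A\<^esub> a) = \<ominus>\<^bsub>B\<^esub> (b \<ominus>\<^bsub>B\<^esub> f a)"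
      by (simp add: S.minus_eq S.minus_add)
    with * show "\<ominus>\<^bsub>RDirProd A B\<^esub> (a, b) \<in> amalg_set B f J (carrier A)"
      using J.a_inv_closed
      by (simp add: RDirProd_a_inv R.ring_axioms S.ring_axioms amalg_set_iff)
  next
    fix a b c d
    assume "(a, b) \<in> amalg_set B f J (carrier A)" "(c, d) \<in> amalg_set B f J (carrier A)"
    then have *: "a \<in> carrier A" "b \<in> carrier B" "b \<ominus>\<^bsub>B\<^esub> f a \<in> J"
      "c \<in> carrier A" "d \<in> carrier B" "d \<ominus>\<^bsub>B\<^esub> f c \<in> J"
      by (simp_all add: amalg_set_iff)
    \<comment> \<open>Add and subtract \<open>b * f c\<close>: both summands then have a factor in
      \<open>J\<close>, and \<open>J\<close> absorbs multiplication from either side.\<close>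
    then have "b \<otimes>\<^bsub>B\<^esub> d \<ominus>\<^bsub>B\<^esub> f (a \<otimes>\<^bsub>A\<^esub> c)
        = b \<otimes>\<^bsub>B\<^esub> (d \<ominus>\<^bsub>B\<^esub> f c) \<oplus>\<^bsub>B\<^esub> (b \<ominus>\<^bsub>B\<^esub> f a) \<otimes>\<^bsub>B\<^esub> f c"
      by (simp add: S.minus_eq S.l_distr S.r_distr S.r_minus S.l_minus S.a_assoc S.l_neg S.r_neg1)
    with * show "(a, b) \<otimes>\<^bsub>RDirProd A B\<^esub> (c, d) \<in> amalg_set B f J (carrier A)"
      by (simp add: amalg_set_iff J.I_l_closed J.I_r_closed)
    from * have "(b \<oplus>\<^bsub>B\<^esub> d) \<ominus>\<^bsub>B\<^esub> f (a \<oplus>\<^bsub>A\<^esub> c) = (b \<ominus>\<^bsub>B\<^esub> f a) \<oplus>\<^bsub>B\<^esub> (d \<ominus>\<^bsub>B\<^esub> f c)"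
      by (simp add: S.minus_eq S.minus_add S.a_ac)
    with * show "(a, b) \<oplus>\<^bsub>RDirProd A B\<^esub> (c, d) \<in> amalg_set B f J (carrier A)"
      by (simp add: amalg_set_iff)
  qed
qed

abbreviation amalg where "amalg \<equiv> amalgamation A B f J"

lemma amalg_simps [simp]:
  "carrier amalg = amalg_set B f J (carrier A)"
  "x \<otimes>\<^bsub>amalg\<^esub> y = x \<otimes>\<^bsub>RDirProd A B\<^esub> y"
  "x \<oplus>\<^bsub>amalg\<^esub> y = x \<oplus>\<^bsub>RDirProd A B\<^esub> y"
  "\<zero>\<^bsub>amalg\<^esub> = \<zero>\<^bsub>RDirProd A B\<^esub>"
  "\<one>\<^bsub>amalg\<^esub> = \<one>\<^bsub>RDirProd A B\<^esub>"
  by (simp_all add: amalgamation_def)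

lemma amalg_nat_pow: "(a, b) [^]\<^bsub>amalg\<^esub> (k::nat) = (a [^]\<^bsub>A\<^esub> k, b [^]\<^bsub>B\<^esub> k)"
  by (induction k) simp_all

lemma ring_amalg: "ring amalg"
  unfolding amalgamation_def
  using ring.subring_is_ring[OF RDirProd_ring amalg_set_subring] R.ring_axioms S.ring_axioms
  by blast

text \<open>Makes ideals of the amalgamation available as preimages of ideals of
  \<open>A\<close>.\<close>

lemma fst_ring_hom: "ring_hom_ring amalg A fst"
  using ring_amalg R.ring_axioms
  by (rule ring_hom_ringI) (auto simp: amalg_set_iff)

text \<open>The congruence modulo \<open>J\<close> is already part of membership in the carrier, so
  what remains is a condition on the first component alone.\<close>

lemma amalg_set_conv_vimage:
  assumes "K \<subseteq> carrier A"
  shows "amalg_set B f J K = {x \<in> carrier amalg. fst x \<in> K}"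
  using assms by (auto simp: amalg_set_iff)

lemma amalg_set_ideal:
  assumes "ideal K A"
  shows "ideal (amalg_set B f J K) amalg"
  using ring_hom_ring.ideal_vimage[OF fst_ring_hom assms] ideal.Icarr[OF assms]
  by (subst amalg_set_conv_vimage) auto

lemma amalg_element:
  assumes "a \<in> carrier A" "j \<in> J"
  shows "(a, f a \<oplus>\<^bsub>B\<^esub> j) \<in> carrier amalg"
  using assms by (auto simp: amalg_set_def)

text \<open>Parametrizes the carrier by \<open>a\<close> and \<open>j\<close>, the form in which the
  condition on unbreakable zeros quantifies.\<close>

lemma amalg_ball:
  "(\<forall>x \<in> carrier amalg. P x) \<longleftrightarrow> (\<forall>a \<in> carrier A. \<forall>j \<in> J. P (a, f a \<oplus>\<^bsub>B\<^esub> j))"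
  by (auto simp: amalg_set_def)

text \<open>The power stays in the carrier, so only its first component decides, and that component
  does not involve \<open>j\<close>.\<close>

lemma nat_pow_mem_amalg_set:
  assumes "K \<subseteq> carrier A" "a \<in> carrier A" "j \<in> J"
  shows "(a, f a \<oplus>\<^bsub>B\<^esub> j) [^]\<^bsub>amalg\<^esub> (k::nat) \<in> amalg_set B f J K \<longleftrightarrow> a [^]\<^bsub>A\<^esub> k \<in> K"
proof -
  interpret amalg: ring amalg by (rule ring_amalg)
  have "(a, f a \<oplus>\<^bsub>B\<^esub> j) [^]\<^bsub>amalg\<^esub> k \<in> carrier amalg"
    using assms by (intro amalg.nat_pow_closed amalg_element)
  then show ?thesis
    unfolding amalg_set_conv_vimage[OF assms(1)] by (simp add: amalg_nat_pow)
qed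

lemma amalg_set_eq_carrier_iff:
  assumes "K \<subseteq> carrier A"
  shows "amalg_set B f J K = carrier amalg \<longleftrightarrow> K = carrier A"
proof
  assume eq: "amalg_set B f J K = carrier amalg"
  have "a \<in> K" if "a \<in> carrier A" for a
    \<comment> \<open>The witness over \<open>a\<close> is \<open>(a, f a + 0)\<close>.\<close>
    using amalg_element[OF that J.zero_closed] assms unfolding eq[symmetric] by (simp add: amalg_set_iff)
  with assms show "K = carrier A" by auto
qed simp

text \<open>Lets a quantifier over \<open>j\<close> be dropped when its body does not depend on
  \<open>j\<close>.\<close>

lemma ex_J: "\<exists>j. j \<in> J"
  using J.zero_closed by blast

context
  fixes I \<delta> \<delta>' and m n :: nat
  assumes I: "ideal I A" and expansion: "ideal (\<delta> I) A"
    and \<delta>': "\<delta>' (amalg_set B f J I) = amalg_set B f J (\<delta> I)"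
begin

lemma
  shows I_subset: "I \<subseteq> carrier A" and \<delta>_subset: "\<delta> I \<subseteq> carrier A"
  using ideal.Icarr[OF I] ideal.Icarr[OF expansion] by auto

text \<open>Hypothesis and conclusion are both membership conditions on powers, hence independent of
  \<open>j\<close>, and \<open>J\<close> is nonempty.\<close>

lemma closed_primary_amalg_iff:
  "closed_primary amalg \<delta>' m n (amalg_set B f J I) \<longleftrightarrow> closed_primary A \<delta> m n I"
  unfolding closed_primary_def \<delta>' amalg_set_eq_carrier_iff[OF I_subset] amalg_ball
  using ex_J by (auto simp: nat_pow_mem_amalg_set I_subset \<delta>_subset amalg_set_ideal I)

lemma weakly_closed_primary_amalg_iff:
  assumes "1 \<le> n" "n < m"
  shows "weakly_closed_primary amalg \<delta>' m n (amalg_set B f J I) \<longleftrightarrow>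
    weakly_closed_primary A \<delta> m n I \<and>
    (\<forall>a. unbreakable_zero A \<delta> m n I a \<longrightarrow> (\<forall>j \<in> J. (f a \<oplus>\<^bsub>B\<^esub> j) [^]\<^bsub>B\<^esub> m = \<zero>\<^bsub>B\<^esub>))"
proof -
  \<comment> \<open>Needed when \<open>a\<close> has zero \<open>m\<close>-th power: the membership
    premise on that power then holds automatically.\<close>
  have zero: "\<zero>\<^bsub>A\<^esub> \<in> I"
    using I by (simp add: additive_subgroup.zero_closed ideal.axioms(1))
  \<comment> \<open>A pair is nonzero iff one of its components is; this is the only place where
    \<open>j\<close> survives.\<close>
  have "weakly_closed_primary amalg \<delta>' m n (amalg_set B f J I) \<longleftrightarrow> I \<noteq> carrier A \<and>
    (\<forall>a \<in> carrier A. \<forall>j \<in> J. (a [^]\<^bsub>A\<^esub> m \<noteq> \<zero>\<^bsub>A\<^esub> \<or> (f a \<oplus>\<^bsub>B\<^esub> j) [^]\<^bsub>B\<^esub> m \<noteq> \<zero>\<^bsub>B\<^esub>) \<and>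
      a [^]\<^bsub>A\<^esub> m \<in> I \<longrightarrow> a [^]\<^bsub>A\<^esub> n \<in> \<delta> I)"
    unfolding weakly_closed_primary_def \<delta>' amalg_set_eq_carrier_iff[OF I_subset] amalg_ball
    \<comment> \<open>Membership is settled while the power of the pair is still intact; only then
      is it split into components for the comparison with zero.\<close>
    by (auto simp: nat_pow_mem_amalg_set I_subset \<delta>_subset amalg_set_ideal I)
      (auto simp: amalg_nat_pow)
  \<comment> \<open>Split on whether the \<open>m\<close>-th power of \<open>a\<close> vanishes. If
    not, the condition is weak closedness of \<open>I\<close>, with any \<open>j\<close> as witness.
    If so, it says that a nonzero \<open>m\<close>-th power of \<open>f a + j\<close> puts the
    \<open>n\<close>-th power of \<open>a\<close> into \<open>\<delta> I\<close>, which is the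
    contrapositive of the condition on unbreakable zeros.\<close>
  also have "\<dots> \<longleftrightarrow> weakly_closed_primary A \<delta> m n I \<and>
    (\<forall>a. unbreakable_zero A \<delta> m n I a \<longrightarrow> (\<forall>j \<in> J. (f a \<oplus>\<^bsub>B\<^esub> j) [^]\<^bsub>B\<^esub> m = \<zero>\<^bsub>B\<^esub>))"
    using assms I ex_J zero unfolding unbreakable_zero_def weakly_closed_primary_def
    by (intro iffI) metis+
  finally show ?thesis .
qed

end

end

theorem theorem4p2:
  fixes A :: "('a, 'm) ring_scheme" and B :: "('b, 'k) ring_scheme"
    and f :: "'a \<Rightarrow> 'b" and I :: "'a set" and J :: "'b set"
    and \<delta> :: "'a set \<Rightarrow> 'a set" and \<delta>' :: "('a \<times> 'b) set \<Rightarrow> ('a \<times> 'b) set"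
    and m n :: nat
  assumes "cring A" and "\<one>\<^bsub>A\<^esub> \<noteq> \<zero>\<^bsub>A\<^esub>"
    and "cring B" and "\<one>\<^bsub>B\<^esub> \<noteq> \<zero>\<^bsub>B\<^esub>"
    and "f \<in> ring_hom A B"
    and "ideal J B"
    and "ideal I A" and "I \<noteq> carrier A"
    and "expansion_function A \<delta>"
    and "1 \<le> n" and "n < m"
    and "expansion_function (amalgamation A B f J) \<delta>'"
    and "\<And>K. ideal K A \<Longrightarrow> \<delta>' (amalg_set B f J K) = amalg_set B f J (\<delta> K)"
  shows
    "(weakly_closed_primary (amalgamation A B f J) \<delta>' m n (amalg_set B f J I) \<and>
      \<not> closed_primary (amalgamation A B f J) \<delta>' m n (amalg_set B f J I))
     \<longleftrightarrow>
     (weakly_closed_primary A \<delta> m n I \<and> \<not> closed_primary A \<delta> m n I \<and>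
      (\<forall>a. unbreakable_zero A \<delta> m n I a \<longrightarrow>
         (\<forall>j \<in> J. (f a \<oplus>\<^bsub>B\<^esub> j) [^]\<^bsub>B\<^esub> m = \<zero>\<^bsub>B\<^esub>)))"
proof -
  interpret A: cring A by fact
  interpret B: cring B by fact
  interpret J: ideal J B by fact
  interpret amalgamated_ring A B f J
    using assms(5) by unfold_locales auto
  have "ideal (\<delta> I) A"
    using assms(7,9) by (auto simp: expansion_function_def)
  note * = assms(7) this assms(13)[OF assms(7)]
  show ?thesis
    \<comment> \<open>Each conjunct on the left is carried over to \<open>A\<close> separately; only
      a rearrangement of conjunctions is left.\<close>
    unfolding closed_primary_amalg_iff[where I = I and \<delta> = \<delta> and \<delta>' = \<delta>', OF *]
      weakly_closed_primary_amalg_iff[where I = I and \<delta> = \<delta> and \<delta>' = \<delta>', OF * assms(10,11)]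
    by blast
qed

end
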